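(* Let $m,n$ be positive integers with $n>m\ge 6$ and $2\nmid mn$. Then $$r(K_{1,m-1},T_n^1)=r(K_{1,m-1},T_n^2)=m+n-5.$$
   Context: All graphs are finite simple graphs. For graphs $G_1,G_2$, the Ramsey number $r(G_1,G_2)$ is the smallest positive integer $N$ such that for every graph $G$ on $N$ vertices, either $G$ contains a (not necessarily induced) subgraph isomorphic to $G_1$, or the complement $\overline{G}$ contains a subgraph isomorphic to $G_2$. $K_{1,m-1}$ is the star on $m$ vertices. For $n\ge 5$, with vertex set $\{v_0,v_1,\ldots,v_{n-1}\}$: $T_n^1$ is the tree with edges $v_0v_1,\ldots,v_0v_{n-3},v_{n-4}v_{n-2},v_{n-3}v_{n-1}$; $T_n^2$ is the tree with edges $v_0v_1,\ldots,v_0v_{n-3},v_{n-3}v_{n-2},v_{n-3}v_{n-1}$. *)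

theory Defs
  imports "Graph_Theory.Graph_Theory" "Graph_Theory.Kuratowski"
begin

text \<open>
  A finite simple graph is a \<^locale>\<open>pair_graph\<close>: each undirected edge \<open>uv\<close> is represented by
  the two arcs \<open>(u,v)\<close> and \<open>(v,u)\<close>. Concrete graphs are given by listing every edge in one
  orientation and applying \<^const>\<open>mk_symmetric\<close>.
\<close>

definition complement_graph :: "'a pair_pre_digraph \<Rightarrow> 'a pair_pre_digraph" where
  "complement_graph G =
    \<lparr> pverts = pverts G,
      parcs = {(u, v). u \<in> pverts G \<and> v \<in> pverts G \<and> u \<noteq> v \<and> (u, v) \<notin> parcs G} \<rparr>"

definition contains_copy :: "'a pair_pre_digraph \<Rightarrow> 'b pair_pre_digraph \<Rightarrow> bool" where
  "contains_copy G H \<longleftrightarrow>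
    (\<exists>H' :: 'a pair_pre_digraph.
      subgraph (with_proj H') (with_proj G) \<and> digraph_iso (with_proj H') (with_proj H))"

text \<open>
  Only host graphs with natural numbers as vertices are considered; up to isomorphism these are
  all finite simple graphs.
\<close>

definition ramsey_property :: "'a pair_pre_digraph \<Rightarrow> 'b pair_pre_digraph \<Rightarrow> nat \<Rightarrow> bool" where
  "ramsey_property G1 G2 N \<longleftrightarrow>
    (\<forall>G :: nat pair_pre_digraph. pair_graph G \<and> card (pverts G) = N \<longrightarrow>
      contains_copy G G1 \<or> contains_copy (complement_graph G) G2)"

definition ramsey_number :: "'a pair_pre_digraph \<Rightarrow> 'b pair_pre_digraph \<Rightarrow> nat" where
  "ramsey_number G1 G2 = (LEAST N. 0 < N \<and> ramsey_property G1 G2 N)"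

definition star_graph :: "nat \<Rightarrow> nat pair_pre_digraph" where
  "star_graph k = mk_symmetric (with_proj \<lparr> pverts = {0..k}, parcs = {0} \<times> {1..k} \<rparr>)"

text \<open>The vertex \<open>i\<close> stands for \<open>v\<^sub>i\<close>. Both trees are only meant for \<open>n \<ge> 5\<close>.\<close>

definition tree_T1 :: "nat \<Rightarrow> nat pair_pre_digraph" where
  "tree_T1 n = mk_symmetric (with_proj
    \<lparr> pverts = {0..<n}, parcs = {0} \<times> {1..n - 3} \<union> {(n - 4, n - 2), (n - 3, n - 1)} \<rparr>)"

definition tree_T2 :: "nat \<Rightarrow> nat pair_pre_digraph" where
  "tree_T2 n = mk_symmetric (with_proj
    \<lparr> pverts = {0..<n}, parcs = {0} \<times> {1..n - 3} \<union> {(n - 3, n - 2), (n - 3, n - 1)} \<rparr>)"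

lemma mk_symmetric_with_proj:
  "mk_symmetric (with_proj \<lparr> pverts = V, parcs = E \<rparr>) = \<lparr> pverts = V, parcs = E \<union> E\<inverse> \<rparr>"
  by (auto simp: mk_symmetric_def with_proj_def arcs_ends_def arc_to_ends_def)

lemma pair_graph_mk_symmetric:
  assumes "finite V" "E \<subseteq> V \<times> V" "irrefl E"
  shows "pair_graph (mk_symmetric (with_proj \<lparr> pverts = V, parcs = E \<rparr>))"
proof -
  have "finite E" using assms by (meson finite_SigmaI finite_subset)
  then show ?thesis
    unfolding mk_symmetric_with_proj using assms
    by unfold_locales
      (auto simp: irrefl_def symmetric_def sym_def arcs_ends_def arc_to_ends_def with_proj_def)
qed

lemma pair_graph_complement_graph:
  assumes "pair_graph G"
  shows "pair_graph (complement_graph G)"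
proof -
  interpret pair_graph G by fact
  have "sym (parcs G)" using pair_sym_arcs
    by (auto simp: symmetric_def arcs_ends_def arc_to_ends_def with_proj_def)
  moreover have "finite {(u, v). u \<in> pverts G \<and> v \<in> pverts G \<and> u \<noteq> v \<and> (u, v) \<notin> parcs G}"
    by (rule finite_subset[of _ "pverts G \<times> pverts G"]) (auto simp: pair_finite_verts)
  ultimately show ?thesis
    by unfold_locales
      (auto simp: complement_graph_def pair_finite_verts symmetric_def sym_def arcs_ends_def
        arc_to_ends_def with_proj_def)
qed

lemma pair_graph_tree_T1: "n \<ge> 5 \<Longrightarrow> pair_graph (tree_T1 n)"
  unfolding tree_T1_def by (rule pair_graph_mk_symmetric) (auto simp: irrefl_def)

lemma pair_graph_tree_T2: "n \<ge> 5 \<Longrightarrow> pair_graph (tree_T2 n)"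
  unfolding tree_T2_def by (rule pair_graph_mk_symmetric) (auto simp: irrefl_def)

lemma contains_copy_iff:
  assumes "pair_graph G" "pair_graph H"
  shows "contains_copy G H \<longleftrightarrow>
    (\<exists>f. inj_on f (pverts H) \<and> f ` pverts H \<subseteq> pverts G \<and>
      (\<forall>(u, v) \<in> parcs H. (f u, f v) \<in> parcs G))"
proof -
  interpret G: pair_graph G by fact
  interpret H: pair_graph H by fact
  have wfG: "wf_digraph (with_proj G)" and wfH: "wf_digraph (with_proj H)" by unfold_locales
  show ?thesis
  proof
    assume "contains_copy G H"
    then obtain H' where sub: "subgraph (with_proj H') (with_proj G)"
      and iso: "digraph_iso (with_proj H') (with_proj H)"
      by (auto simp: contains_copy_def)
    from sub have wfH': "wf_digraph (with_proj H')" by (simp add: subgraph_def)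
    from iso obtain h where h: "pre_digraph.digraph_isomorphism (with_proj H') h"
      and eq: "with_proj H = app_iso h (with_proj H')" by (auto simp: digraph_iso_def)
    have inj: "inj_on (iso_verts h) (pverts H')"
      and arcs: "\<And>a. a \<in> parcs H' \<Longrightarrow> iso_verts h (fst a) = iso_tail h (iso_arcs h a)
        \<and> iso_verts h (snd a) = iso_head h (iso_arcs h a)"
      using h by (auto simp: pre_digraph.digraph_isomorphism_def with_proj_def)
    have eqs: "pverts H = iso_verts h ` pverts H'" "parcs H = iso_arcs h ` parcs H'"
      "iso_tail h = fst" "iso_head h = snd"
      using eq by (auto simp: app_iso_def with_proj_def)
    let ?f = "the_inv_into (pverts H') (iso_verts h)"
    have "inj_on ?f (pverts H)" unfolding eqs by (rule inj_on_the_inv_into[OF inj])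
    moreover have "?f ` pverts H \<subseteq> pverts G"
      using sub inj by (auto simp: eqs the_inv_into_f_f subgraph_def with_proj_def)
    moreover have "(?f u, ?f v) \<in> parcs G" if "(u, v) \<in> parcs H" for u v
    proof -
      from that obtain a where a: "a \<in> parcs H'" "iso_arcs h a = (u, v)"
        by (auto simp: eqs)
      have mem: "fst a \<in> pverts H'" "snd a \<in> pverts H'"
        using wf_digraph.tail_in_verts[OF wfH', of a] wf_digraph.head_in_verts[OF wfH', of a] a(1)
        by (auto simp: with_proj_def)
      have "u = iso_verts h (fst a)" "v = iso_verts h (snd a)"
        using arcs[OF a(1)] a(2) by (auto simp: eqs)
      then have "(?f u, ?f v) = a" using mem inj by (simp add: the_inv_into_f_f)
      then show ?thesis using sub a(1) by (auto simp: subgraph_def with_proj_def)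
    qed
    ultimately show "\<exists>f. inj_on f (pverts H) \<and> f ` pverts H \<subseteq> pverts G \<and>
      (\<forall>(u, v) \<in> parcs H. (f u, f v) \<in> parcs G)" by blast
  next
    assume "\<exists>f. inj_on f (pverts H) \<and> f ` pverts H \<subseteq> pverts G \<and>
      (\<forall>(u, v) \<in> parcs H. (f u, f v) \<in> parcs G)"
    then obtain f where inj: "inj_on f (pverts H)" and sub: "f ` pverts H \<subseteq> pverts G"
      and arcs: "\<And>u v. (u, v) \<in> parcs H \<Longrightarrow> (f u, f v) \<in> parcs G" by fast
    let ?h = "\<lparr> iso_verts = f, iso_arcs = map_prod f f, iso_head = snd, iso_tail = fst \<rparr>"
    let ?H' = "\<lparr> pverts = f ` pverts H, parcs = map_prod f f ` parcs H \<rparr>"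
    have "parcs H \<subseteq> pverts H \<times> pverts H"
      using H.arc_fst_in_verts H.arc_snd_in_verts by fastforce
    then have inj2: "inj_on (map_prod f f) (parcs H)"
      using inj_on_subset[OF map_prod_inj_on[OF inj inj]] by blast
    have isom: "pre_digraph.digraph_isomorphism (with_proj H) ?h"
      unfolding pre_digraph.digraph_isomorphism_def
      using wfH inj inj2 by (auto simp: with_proj_def)
    moreover have eq: "with_proj ?H' = app_iso ?h (with_proj H)"
      by (auto simp: app_iso_def with_proj_def)
    ultimately have "digraph_iso (with_proj H) (with_proj ?H')"
      by (auto simp: digraph_iso_def)
    then have "digraph_iso (with_proj ?H') (with_proj H)"
      by (rule digraph_iso_swap[OF wfH])
    moreover have "wf_digraph (with_proj ?H')"
      using H.arc_fst_in_verts H.arc_snd_in_verts by unfold_locales (force simp: with_proj_def)+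
    then have "subgraph (with_proj ?H') (with_proj G)"
      using sub arcs wfG by (auto simp: subgraph_def with_proj_def compatible_def)
    ultimately show "contains_copy G H" unfolding contains_copy_def by blast
  qed
qed

lemma star_graph_complete_bipartite: "complete_bipartite_digraph 1 k (with_proj (star_graph k))"
proof -
  have "pair_graph (star_graph k)"
    unfolding star_graph_def by (rule pair_graph_mk_symmetric) (auto simp: irrefl_def)
  then interpret pair_graph "star_graph k" .
  have "graph (with_proj (star_graph k))" by unfold_locales
  moreover have "arcs_ends (with_proj (star_graph k)) = {0} \<times> {1..k} \<union> {1..k} \<times> {0}"
    and "verts (with_proj (star_graph k)) = {0} \<union> {1..k}"
    unfolding star_graph_def mk_symmetric_with_proj
    by (auto simp: arcs_ends_def arc_to_ends_def with_proj_def image_iff)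
  moreover have "{0::nat} \<inter> {1..k} = {}" "card {0::nat} = 1" "card {1..k} = k" by auto
  ultimately show ?thesis
    unfolding complete_bipartite_digraph_def by blast
qed

end

theory Submission
  imports Defs
begin

text \<open>
  A graph without \<open>K\<^sub>1\<^sub>,\<^sub>m\<^sub>-\<^sub>1\<close> has maximum degree at most \<open>m - 2\<close>, so on \<open>m + n - 5\<close> vertices its
  complement has minimum degree at least \<open>n - 4\<close>. As \<open>m + n - 5\<close> and \<open>n - 4\<close> are both odd, the
  complement is not \<open>(n - 4)\<close>-regular, and some vertex \<open>v\<close> has degree at least \<open>n - 3\<close>; it serves
  as the centre of the tree. Every non-neighbour of \<open>v\<close> has neighbours among the neighbours of
  \<open>v\<close>, and from these the two remaining vertices of the tree are chosen.

  For the lower bound, an \<open>(m - 3)\<close>-regular circulant graph on \<open>m + n - 6\<close> vertices exists because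
  \<open>m - 3\<close> is even; its complement is \<open>(n - 4)\<close>-regular, while both trees have a vertex of degree
  \<open>n - 3\<close>.
\<close>

section \<open>Stars and double-leaf trees\<close>

lemma pair_graph_parcs:
  assumes "pair_graph G"
  shows "finite (pverts G)" "parcs G \<subseteq> pverts G \<times> pverts G" "sym (parcs G)" "irrefl (parcs G)"
proof -
  interpret pair_graph G by fact
  show "finite (pverts G)" by simp
  show "parcs G \<subseteq> pverts G \<times> pverts G"
    using arc_fst_in_verts arc_snd_in_verts by fastforce
  show "sym (parcs G)" using pair_sym_arcs
    by (auto simp: symmetric_def arcs_ends_def arc_to_ends_def with_proj_def)
  show "irrefl (parcs G)" using pair_no_loops by (force simp: irrefl_def)
qed

lemma pair_graphI:
  assumes "finite (pverts G)" "parcs G \<subseteq> pverts G \<times> pverts G" "sym (parcs G)" "irrefl (parcs G)"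
  shows "pair_graph G"
proof -
  have "finite (parcs G)" using assms by (meson finite_SigmaI finite_subset)
  then show ?thesis using assms
    by unfold_locales
      (auto simp: irrefl_def symmetric_def sym_def arcs_ends_def arc_to_ends_def with_proj_def)
qed

lemma pair_graph_star: "pair_graph (star_graph k)"
  unfolding star_graph_def by (rule pair_graph_mk_symmetric) (auto simp: irrefl_def)

text \<open>The image of \<open>0\<close> keeps \<open>k\<close> distinct neighbours. Hence a host
  whose degrees are all below \<open>k\<close> contains no copy of \<open>H\<close>; the lower bound
  uses this for the star and for both trees.\<close>

lemma contains_copy_degree:
  assumes G: "pair_graph G" and H: "pair_graph H" and copy: "contains_copy G H"
    and star: "{0::nat} \<times> {1..k} \<subseteq> parcs H" and k: "0 < k"
  obtains v where "v \<in> pverts G" "k \<le> card (parcs G `` {v})"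
proof -
  obtain f where inj: "inj_on f (pverts H)" and sub: "f ` pverts H \<subseteq> pverts G"
    and arcs: "\<And>u v. (u, v) \<in> parcs H \<Longrightarrow> (f u, f v) \<in> parcs G"
    using copy contains_copy_iff[OF G H] by fast
  have V: "0 \<in> pverts H" "{1..k} \<subseteq> pverts H" using pair_graph_parcs(2)[OF H] star k by force+
  have "parcs G `` {f 0} \<subseteq> pverts G" using pair_graph_parcs(2)[OF G] by auto
  then have fin: "finite (parcs G `` {f 0})"
    using pair_graph_parcs(1)[OF G] finite_subset by blast
  have "k = card (f ` {1..k})" using inj_on_subset[OF inj V(2)] by (simp add: card_image)
  also have "\<dots> \<le> card (parcs G `` {f 0})" using star arcs fin by (intro card_mono) auto
  finally show thesis using that V(1) sub by blast
qed

text \<open>Embeddings are given as vertex lists, entry \<open>i\<close> being the image of vertex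
  \<open>i\<close>, so that injectivity becomes distinctness.\<close>

lemma contains_copy_nthI:
  assumes G: "pair_graph G" and H: "pair_graph H" and V: "pverts H = {0..<length xs}"
    and "distinct xs" "set xs \<subseteq> pverts G"
    and "\<And>i j. (i, j) \<in> parcs H \<Longrightarrow> (xs ! i, xs ! j) \<in> parcs G"
  shows "contains_copy G H"
  unfolding contains_copy_iff[OF G H] V
  using assms by (intro exI[of _ "(!) xs"]) (auto simp: inj_on_nth subset_iff)

lemma contains_copy_star:
  assumes G: "pair_graph G" and v: "v \<in> pverts G" and deg: "k \<le> card (parcs G `` {v})"
  shows "contains_copy G (star_graph k)"
proof -
  note g = pair_graph_parcs[OF G]
  obtain B where B: "B \<subseteq> parcs G `` {v}" "card B = k" "finite B"
    using obtain_subset_with_card_n[OF deg] by blast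
  then obtain bs where bs: "set bs = B" "distinct bs"
    using finite_distinct_list by blast
  then have len: "length bs = k" using B distinct_card by fastforce
  show ?thesis
  proof (rule contains_copy_nthI[OF G pair_graph_star, of _ "v # bs"])
    have nb: "(v, bs ! (i - 1)) \<in> parcs G" if "1 \<le> i" "i \<le> k" for i
      using bs(1) B(1) len that nth_mem[of "i - 1" bs] by auto
    show "((v # bs) ! i, (v # bs) ! j) \<in> parcs G" if "(i, j) \<in> parcs (star_graph k)" for i j
      using that nb[of i] nb[of j] symD[OF g(3)]
      by (auto simp: star_graph_def mk_symmetric_with_proj)
  qed (use B bs len g v in \<open>auto simp: star_graph_def mk_symmetric_with_proj irrefl_def\<close>)
qed

lemma obtain_distinct_list:
  assumes "finite A" "C \<subseteq> A" "card C + k \<le> card A"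
  obtains xs where "distinct xs" "length xs = k" "set xs \<subseteq> A - C"
proof -
  have "k \<le> card (A - C)" using assms by (simp add: card_Diff_subset finite_subset)
  then obtain B where B: "B \<subseteq> A - C" "card B = k" "finite B"
    using obtain_subset_with_card_n by blast
  then obtain xs where "set xs = B" "distinct xs"
    using finite_distinct_list by blast
  with B show thesis using that distinct_card by fastforce
qed

text \<open>Here \<open>v\<close> is the centre, and \<open>x\<close>, \<open>x'\<close> hang from
  its neighbours \<open>u\<close>, \<open>u'\<close>. Since \<open>x\<close> and \<open>x'\<close>
  may themselves be neighbours of \<open>v\<close>, they are removed before the neighbours available
  as star leaves are counted.\<close>

lemma contains_copy_T1:
  assumes G: "pair_graph G" and n: "5 \<le> n" and dist: "distinct [v, u, u', x, x']"
    and arcs: "(v, u) \<in> parcs G" "(v, u') \<in> parcs G" "(u, x) \<in> parcs G" "(u', x') \<in> parcs G"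
    and deg: "n - 3 \<le> card (parcs G `` {v} - {x, x'})"
  shows "contains_copy G (tree_T1 n)"
proof -
  note g = pair_graph_parcs[OF G]
  have fin: "finite (parcs G `` {v} - {x, x'})"
    using g(1,2) by (auto intro: finite_subset[of _ "pverts G"])
  obtain as where as: "distinct as" "length as = n - 5"
      "set as \<subseteq> parcs G `` {v} - {x, x'} - {u, u'}"
    by (rule obtain_distinct_list[of "parcs G `` {v} - {x, x'}" "{u, u'}" "n - 5"])
      (use fin arcs dist deg n in auto)
  \<comment> \<open>Listing \<open>u\<close>, \<open>u'\<close> last puts them at positions
    \<open>n - 4\<close> and \<open>n - 3\<close> of \<open>xs\<close>, the two star leaves that the
    tree extends.\<close>
  define bs where "bs = as @ [u, u']"
  define xs where "xs = v # bs @ [x, x']"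
  have len: "length bs = n - 3" "length xs = n" using as n by (auto simp: bs_def xs_def)
  have bs: "set bs \<subseteq> parcs G `` {v}" using as arcs by (auto simp: bs_def)
  have nb: "(xs ! 0, xs ! i) \<in> parcs G" if "1 \<le> i" "i \<le> n - 3" for i
  proof -
    have "bs ! (i - 1) \<in> parcs G `` {v}" using len(1) that by (intro subsetD[OF bs] nth_mem) simp
    moreover have "i - 1 < length bs" using that len(1) by simp
    ultimately show ?thesis using that by (simp add: xs_def nth_Cons' nth_append)
  qed
  have nth: "xs ! (n - 4) = u" "xs ! (n - 3) = u'" "xs ! (n - 2) = x" "xs ! (n - 1) = x'"
    using n as by (auto simp: xs_def bs_def nth_Cons' nth_append)
  show ?thesis
  proof (rule contains_copy_nthI[OF G pair_graph_tree_T1[OF n], of xs])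
    show "distinct xs" "set xs \<subseteq> pverts G"
      using as dist bs arcs g(2,4) by (auto simp: xs_def bs_def irrefl_def)
    show "(xs ! i, xs ! j) \<in> parcs G" if "(i, j) \<in> parcs (tree_T1 n)" for i j
    proof -
      have "(i, j) \<in> {0} \<times> {1..n - 3} \<union> {(n - 4, n - 2), (n - 3, n - 1)} \<or>
            (j, i) \<in> {0} \<times> {1..n - 3} \<union> {(n - 4, n - 2), (n - 3, n - 1)}"
        using that by (auto simp: tree_T1_def mk_symmetric_with_proj)
      moreover have "(xs ! i, xs ! j) \<in> parcs G"
        if "(i, j) \<in> {0} \<times> {1..n - 3} \<union> {(n - 4, n - 2), (n - 3, n - 1)}" for i j
        using that nb nth arcs by auto
      ultimately show ?thesis using symD[OF g(3)] by blast
    qed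
  qed (simp add: len tree_T1_def mk_symmetric_with_proj)
qed

text \<open>The same construction with both end vertices \<open>x\<close>, \<open>y\<close> attached
  to the single leaf \<open>u\<close>, which therefore takes position \<open>n - 3\<close>.\<close>

lemma contains_copy_T2:
  assumes G: "pair_graph G" and n: "5 \<le> n" and dist: "distinct [v, u, x, y]"
    and arcs: "(v, u) \<in> parcs G" "(u, x) \<in> parcs G" "(u, y) \<in> parcs G"
    and deg: "n - 3 \<le> card (parcs G `` {v} - {x, y})"
  shows "contains_copy G (tree_T2 n)"
proof -
  note g = pair_graph_parcs[OF G]
  have fin: "finite (parcs G `` {v} - {x, y})"
    using g(1,2) by (auto intro: finite_subset[of _ "pverts G"])
  obtain as where as: "distinct as" "length as = n - 4"
      "set as \<subseteq> parcs G `` {v} - {x, y} - {u}"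
    by (rule obtain_distinct_list[of "parcs G `` {v} - {x, y}" "{u}" "n - 4"])
      (use fin arcs dist deg n in auto)
  define bs where "bs = as @ [u]"
  define xs where "xs = v # bs @ [x, y]"
  have len: "length bs = n - 3" "length xs = n" using as n by (auto simp: bs_def xs_def)
  have bs: "set bs \<subseteq> parcs G `` {v}" using as arcs by (auto simp: bs_def)
  have nb: "(xs ! 0, xs ! i) \<in> parcs G" if "1 \<le> i" "i \<le> n - 3" for i
  proof -
    have "bs ! (i - 1) \<in> parcs G `` {v}" using len(1) that by (intro subsetD[OF bs] nth_mem) simp
    moreover have "i - 1 < length bs" using that len(1) by simp
    ultimately show ?thesis using that by (simp add: xs_def nth_Cons' nth_append)
  qed
  have nth: "xs ! (n - 3) = u" "xs ! (n - 2) = x" "xs ! (n - 1) = y"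
    using n as by (auto simp: xs_def bs_def nth_Cons' nth_append)
  show ?thesis
  proof (rule contains_copy_nthI[OF G pair_graph_tree_T2[OF n], of xs])
    show "distinct xs" "set xs \<subseteq> pverts G"
      using as dist bs arcs g(2,4) by (auto simp: xs_def bs_def irrefl_def)
    show "(xs ! i, xs ! j) \<in> parcs G" if "(i, j) \<in> parcs (tree_T2 n)" for i j
    proof -
      have "(i, j) \<in> {0} \<times> {1..n - 3} \<union> {(n - 3, n - 2), (n - 3, n - 1)} \<or>
            (j, i) \<in> {0} \<times> {1..n - 3} \<union> {(n - 3, n - 2), (n - 3, n - 1)}"
        using that by (auto simp: tree_T2_def mk_symmetric_with_proj)
      moreover have "(xs ! i, xs ! j) \<in> parcs G"
        if "(i, j) \<in> {0} \<times> {1..n - 3} \<union> {(n - 3, n - 2), (n - 3, n - 1)}" for i j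
        using that nb nth arcs by auto
      ultimately show ?thesis using symD[OF g(3)] by blast
    qed
  qed (simp add: len tree_T2_def mk_symmetric_with_proj)
qed

section \<open>Trees in graphs of large minimum degree\<close>

text \<open>The linear order selects one orientation of each edge, so \<open>E\<close> splits into a
  set of arcs and its converse, which are disjoint and equally large.\<close>

lemma even_card_sym_irrefl:
  fixes E :: "('a :: linorder) rel"
  assumes "finite E" "sym E" "irrefl E"
  shows "even (card E)"
proof -
  let ?A = "{(u, v) \<in> E. u < v}"
  have E: "E = ?A \<union> ?A\<inverse>" using assms(2,3) by (auto simp: sym_def irrefl_def) (metis linorder_less_linear)
  have "finite ?A" using assms(1) by (auto intro: finite_subset)
  moreover have "?A \<inter> ?A\<inverse> = {}" by auto
  ultimately have "card (?A \<union> ?A\<inverse>) = card ?A + card (?A\<inverse>)"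
    by (intro card_Un_disjoint) auto
  then show ?thesis using E by simp
qed

text \<open>Handshake argument: the number of arcs is even and equals the order times
  \<open>d\<close>.\<close>

lemma odd_regular_even_order:
  fixes G :: "('a :: linorder) pair_pre_digraph"
  assumes G: "pair_graph G" and deg: "\<And>v. v \<in> pverts G \<Longrightarrow> card (parcs G `` {v}) = d"
    and "odd d"
  shows "even (card (pverts G))"
proof -
  note g = pair_graph_parcs[OF G]
  have fin: "finite (parcs G)" using g(1,2) by (meson finite_SigmaI finite_subset)
  have "parcs G = (SIGMA v:pverts G. parcs G `` {v})" using g(2) by auto
  then have "card (parcs G) = card (SIGMA v:pverts G. parcs G `` {v})" by simp
  also have "\<dots> = (\<Sum>v\<in>pverts G. card (parcs G `` {v}))"
    using fin g(1) by (intro card_SigmaI) (auto intro: finite_Image)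
  also have "\<dots> = card (pverts G) * d" using deg by simp
  finally show ?thesis using even_card_sym_irrefl[OF fin g(3,4)] \<open>odd d\<close> by simp
qed

text \<open>\<open>G\<close> plays the complement of a graph without the star, and \<open>v\<close>
  becomes the centre of the tree. The set \<open>W\<close> below consists of the non-neighbours of
  \<open>v\<close>.\<close>

locale dense_graph =
  fixes G :: "'a pair_pre_digraph" and m n :: nat and v :: 'a
  assumes G: "pair_graph G" and m: "7 \<le> m" and mn: "m + 2 \<le> n"
    and card_V: "card (pverts G) = m + n - 5"
    and min_degree: "\<And>w. w \<in> pverts G \<Longrightarrow> n - 4 \<le> card (parcs G `` {w})"
    and v: "v \<in> pverts G" and degree_v: "n - 3 \<le> card (parcs G `` {v})"
begin

abbreviation E where "E \<equiv> parcs G"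
abbreviation A where "A \<equiv> E `` {v}"
definition W where "W = pverts G - insert v A"

lemmas g = pair_graph_parcs[OF G]

lemma nb_verts: "E `` {w} \<subseteq> pverts G" using g(2) by auto

lemma fin_nb: "finite (E `` {w})" using nb_verts g(1) by (rule finite_subset)

lemma v_notin_A: "v \<notin> A" using g(4) by (auto simp: irrefl_def)

lemma fin_W: "finite W" using g(1) by (simp add: W_def)

lemma card_W: "card W = m + n - 6 - card A"
  unfolding W_def using v v_notin_A nb_verts[of v] fin_nb[of v] card_V
  by (subst card_Diff_subset) auto

lemma A_verts: "u \<in> A \<Longrightarrow> u \<in> pverts G" using nb_verts by auto

text \<open>Since n \<ge> 9, every degree is at least 5, so four vertices cannot exhaust a
  neighbourhood.\<close>

lemma fresh_neighbour:
  assumes "u \<in> A"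
  obtains x where "(u, x) \<in> E" "x \<notin> {a, b, c, d}"
proof -
  have "card {a, b, c, d} \<le> 4" by (simp add: card_insert_if)
  then have "card {a, b, c, d} < card (E `` {u})"
    using min_degree[OF A_verts[OF assms]] m mn by linarith
  then have "\<not> E `` {u} \<subseteq> {a, b, c, d}" using card_mono leD by (metis finite.emptyI finite.insertI)
  then show thesis using that by auto
qed

text \<open>As \<open>w\<close> is not adjacent to \<open>v\<close>, its at least
  \<open>n - 4\<close> neighbours lie in \<open>A\<close> or among the other
  \<open>card W - 1\<close> vertices of \<open>W\<close>.\<close>

lemma card_common:
  assumes w: "w \<in> W"
  shows "n - 3 \<le> card (E `` {w} \<inter> A) + card W"
proof -
  have "E `` {w} \<subseteq> (E `` {w} \<inter> A) \<union> (W - {w})"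
    using w nb_verts[of w] g(3,4) by (auto simp: W_def irrefl_def dest: symD)
  then have "card (E `` {w}) \<le> card ((E `` {w} \<inter> A) \<union> (W - {w}))"
    using fin_nb fin_W by (intro card_mono) auto
  also have "\<dots> \<le> card (E `` {w} \<inter> A) + card (W - {w})" by (rule card_Un_le)
  also have "card (W - {w}) = card W - 1" using w fin_W by simp
  finally show ?thesis using min_degree[of w] w card_gt_0_iff[of W] fin_W m mn
    by (auto simp: W_def)
qed

lemma obtain_two_A:
  obtains u where "u \<in> A" "u \<notin> {x, y}"
proof -
  have "card {x, y} \<le> 2" by (simp add: card_insert_if)
  then have "card {x, y} < card A" using degree_v m mn by linarith
  then have "\<not> A \<subseteq> {x, y}" using card_mono leD by (metis finite.emptyI finite.insertI)
  then show thesis using that by auto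
qed

lemma card_Diff_two: "card A - 2 \<le> card (A - {x, y})"
proof -
  have "card {x, y} \<le> 2" by (simp add: card_insert_if)
  then show ?thesis using diff_card_le_card_Diff[of "{x, y}" A] by simp
qed

text \<open>An end vertex taken from \<open>W\<close> costs no neighbour of \<open>v\<close>; only
  \<open>x\<close> can.\<close>

lemma card_Diff_W:
  assumes "w \<in> W"
  shows "card A - 1 \<le> card (A - {w, x})"
proof -
  have "A - {w, x} = A - {x}" using assms by (auto simp: W_def)
  then show ?thesis using fin_nb by (simp add: card_Diff_singleton_if)
qed

lemma sym_E: "(x, y) \<in> E \<Longrightarrow> (y, x) \<in> E" using g(3) by (rule symD)

text \<open>The bounds on \<open>card A\<close> give m - 4 \<le> \<open>card W\<close> \<le> m - 3.
  So \<open>W\<close> is nonempty and each of its members has at least n - m > 0 neighbours in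
  \<open>A\<close>.\<close>

lemma W_neighbour:
  assumes "card A \<le> n - 2"
  obtains w u where "w \<in> W" "u \<in> A" "(u, w) \<in> E"
proof -
  have "0 < card W" using card_W assms m mn by linarith
  then obtain w where w: "w \<in> W" by fastforce
  have "0 < card (E `` {w} \<inter> A)"
    using card_common[OF w] card_W degree_v assms m mn by linarith
  then obtain u where "u \<in> E `` {w} \<inter> A" by (auto simp: card_gt_0_iff)
  then show thesis using that w sym_E by auto
qed

text \<open>The surplus of \<open>card A\<close> over \<open>n - 3\<close> says how many of the end
  vertices may lie in \<open>A\<close>: both, one or none. The others are taken from
  \<open>W\<close>.\<close>

lemma contains_T1: "contains_copy G (tree_T1 n)"
proof -
  have "\<exists>u u' x x'. distinct [v, u, u', x, x'] \<and> u \<in> A \<and> u' \<in> A \<and> (u, x) \<in> E \<and> (u', x') \<in> E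
    \<and> n - 3 \<le> card (A - {x, x'})"
  proof -
    consider "n - 1 \<le> card A" | "card A = n - 2" | "card A = n - 3"
      using degree_v by linarith
    then show ?thesis
    proof cases
      case 1
      obtain u where u: "u \<in> A" using obtain_two_A by blast
      obtain u' where u': "u' \<in> A" "u' \<noteq> u" using obtain_two_A[of u u] by blast
      obtain x where x: "(u, x) \<in> E" "x \<notin> {v, u', u, u}"
        using fresh_neighbour[OF u, of v u' u u] by blast
      obtain x' where x': "(u', x') \<in> E" "x' \<notin> {v, u, x, u'}"
        using fresh_neighbour[OF u'(1), of v u x u'] by blast
      have "n - 3 \<le> card (A - {x, x'})" using card_Diff_two[of x x'] 1 by linarith
      then show ?thesis using u u' x x' v_notin_A
        by (intro exI[of _ u] exI[of _ u'] exI[of _ x] exI[of _ x']) auto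
    next
      case 2
      then obtain w u where w: "w \<in> W" and u: "u \<in> A" "(u, w) \<in> E"
        using W_neighbour by auto
      obtain u' where u': "u' \<in> A" "u' \<noteq> u" using obtain_two_A[of u u] by blast
      obtain x' where x': "(u', x') \<in> E" "x' \<notin> {v, u, w, u'}"
        using fresh_neighbour[OF u'(1), of v u w u'] by blast
      have "n - 3 \<le> card (A - {w, x'})" using card_Diff_W[OF w, of x'] 2 by linarith
      then show ?thesis using u u' w x' v_notin_A
        by (intro exI[of _ u] exI[of _ u'] exI[of _ w] exI[of _ x']) (auto simp: W_def)
    next
      case 3
      then have W: "card W = m - 3" using card_W m mn by linarith
      then obtain w w' where w: "w \<in> W" "w' \<in> W" "w \<noteq> w'"
        using m card_le_Suc0_iff_eq[OF fin_W] by force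
      \<comment> \<open>The bound is n - m \<ge> 2. A second neighbour of \<open>w'\<close> in
        \<open>A\<close> allows \<open>u'\<close> to differ from \<open>u\<close>.\<close>
      have two: "2 \<le> card (E `` {z} \<inter> A)" if "z \<in> W" for z
        using card_common[OF that] W m mn by linarith
      have "E `` {w} \<inter> A \<noteq> {}" using two[OF w(1)] by force
      then obtain u where u: "u \<in> E `` {w} \<inter> A" by auto
      have "\<not> E `` {w'} \<inter> A \<subseteq> {u}"
        using two[OF w(2)] card_mono[of "{u}" "E `` {w'} \<inter> A"] by auto
      then obtain u' where u': "u' \<in> E `` {w'} \<inter> A" "u' \<noteq> u" by auto
      have "A - {w, w'} = A" using w by (auto simp: W_def)
      then have "n - 3 \<le> card (A - {w, w'})" using 3 by simp
      then show ?thesis using u u' w sym_E v_notin_A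
        by (intro exI[of _ u] exI[of _ u'] exI[of _ w] exI[of _ w']) (auto simp: W_def)
    qed
  qed
  then show ?thesis using contains_copy_T1[OF G, of n v] m mn by fastforce
qed

text \<open>
  Otherwise the sets \<open>E `` {w} \<inter> A\<close> for \<open>w \<in> W\<close> would be pairwise disjoint, giving
  \<open>(m - 3) (n - m) \<le> \<bar>A\<bar> = n - 3\<close>, which fails for \<open>n \<ge> m + 2\<close>.
\<close>

lemma two_W_neighbours:
  assumes A: "card A = n - 3"
  obtains u x y where "u \<in> A" "x \<in> W" "y \<in> W" "x \<noteq> y" "(u, x) \<in> E" "(u, y) \<in> E"
proof (rule ccontr)
  assume "\<not> thesis"
  then have disj: "\<forall>x\<in>W. \<forall>y\<in>W. x \<noteq> y \<longrightarrow> (E `` {x} \<inter> A) \<inter> (E `` {y} \<inter> A) = {}"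
    using that sym_E by fast
  have W: "card W = m - 3" using card_W A m mn by linarith
  have "(m - 3) * (n - m) = (\<Sum>w\<in>W. n - m)" by (simp add: W)
  also have "\<dots> \<le> (\<Sum>w\<in>W. card (E `` {w} \<inter> A))"
    using card_common W m mn by (intro sum_mono) fastforce
  also have "\<dots> = card (\<Union>w\<in>W. E `` {w} \<inter> A)"
    using disj fin_W fin_nb by (intro card_UN_disjoint[symmetric]) auto
  also have "\<dots> \<le> card A" using fin_nb by (intro card_mono) auto
  finally have le: "(m - 3) * (n - m) \<le> n - 3" using A by simp
  \<comment> \<open>In terms of \<open>a\<close> and \<open>t\<close> the inequality reads (a + 4)(t
    + 2) \<le> a + t + 6, but the left side expands to at + 2a + 4t + 8.\<close>
  obtain a where a: "m = a + 7" using m le_Suc_ex by (metis add.commute)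
  obtain t where t: "n = m + 2 + t" using mn le_Suc_ex by blast
  from le show False unfolding t a by (simp add: algebra_simps)
qed

text \<open>The same split by surplus, now with both end vertices adjacent to one \<open>u\<close>.
  Without surplus, \<open>u\<close> needs two neighbours in \<open>W\<close>, which
  \<open>two_W_neighbours\<close> supplies.\<close>

lemma contains_T2: "contains_copy G (tree_T2 n)"
proof -
  have "\<exists>u x y. distinct [v, u, x, y] \<and> u \<in> A \<and> (u, x) \<in> E \<and> (u, y) \<in> E
    \<and> n - 3 \<le> card (A - {x, y})"
  proof -
    consider "n - 1 \<le> card A" | "card A = n - 2" | "card A = n - 3"
      using degree_v by linarith
    then show ?thesis
    proof cases
      case 1
      obtain u where u: "u \<in> A" using obtain_two_A by blast
      obtain x where x: "(u, x) \<in> E" "x \<notin> {v, u, u, u}"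
        using fresh_neighbour[OF u, of v u u u] by blast
      obtain y where y: "(u, y) \<in> E" "y \<notin> {v, u, x, x}"
        using fresh_neighbour[OF u, of v u x x] by blast
      have "n - 3 \<le> card (A - {x, y})" using card_Diff_two[of x y] 1 by linarith
      then show ?thesis using u x y v_notin_A
        by (intro exI[of _ u] exI[of _ x] exI[of _ y]) auto
    next
      case 2
      then obtain w u where w: "w \<in> W" and u: "u \<in> A" "(u, w) \<in> E"
        using W_neighbour by auto
      obtain y where y: "(u, y) \<in> E" "y \<notin> {v, u, w, w}"
        using fresh_neighbour[OF u(1), of v u w w] by blast
      have "n - 3 \<le> card (A - {w, y})" using card_Diff_W[OF w, of y] 2 by linarith
      then show ?thesis using u w y v_notin_A
        by (intro exI[of _ u] exI[of _ w] exI[of _ y]) (auto simp: W_def)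
    next
      case 3
      then obtain u x y where u: "u \<in> A" "x \<in> W" "y \<in> W" "x \<noteq> y" "(u, x) \<in> E" "(u, y) \<in> E"
        using two_W_neighbours by blast
      have "A - {x, y} = A" using u by (auto simp: W_def)
      then have "n - 3 \<le> card (A - {x, y})" using 3 by simp
      then show ?thesis using u v_notin_A
        by (intro exI[of _ u] exI[of _ x] exI[of _ y]) (auto simp: W_def)
    qed
  qed
  then show ?thesis using contains_copy_T2[OF G, of n v] m mn by fastforce
qed

end

section \<open>Upper bound: passing to the complement\<close>

lemma card_complement_neighbours:
  assumes G: "pair_graph G" and v: "v \<in> pverts G"
  shows "card (parcs (complement_graph G) `` {v}) = card (pverts G) - 1 - card (parcs G `` {v})"
proof -
  note g = pair_graph_parcs[OF G]
  have sub: "parcs G `` {v} \<subseteq> pverts G - {v}" using g(2,4) by (auto simp: irrefl_def)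
  have "parcs (complement_graph G) `` {v} = (pverts G - {v}) - parcs G `` {v}"
    using v by (auto simp: complement_graph_def)
  then show ?thesis using sub g(1) v
    by (simp add: card_Diff_subset finite_subset)
qed

text \<open>Without the star all degrees are at most m - 2, which leaves at least (m + n - 6) - (m -
  2) = n - 4 in the complement. Parity then provides the vertex \<open>v\<close> of larger
  degree.\<close>

lemma star_or_dense_complement:
  fixes G :: "nat pair_pre_digraph"
  assumes "7 \<le> m" "m + 2 \<le> n" "odd m" "odd n"
    and G: "pair_graph G" and V: "card (pverts G) = m + n - 5"
    and no_star: "\<not> contains_copy G (star_graph (m - 1))"
  obtains v where "dense_graph (complement_graph G) m n v"
proof -
  let ?H = "complement_graph G"
  have H: "pair_graph ?H" using G by (rule pair_graph_complement_graph)
  have VH: "pverts ?H = pverts G" by (simp add: complement_graph_def)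
  have deg: "n - 4 \<le> card (parcs ?H `` {v})" if "v \<in> pverts G" for v
    using card_complement_neighbours[OF G that] contains_copy_star[OF G that, of "m - 1"]
      no_star V assms(1,2) by linarith
  have "\<exists>v\<in>pverts G. n - 3 \<le> card (parcs ?H `` {v})"
  proof (rule ccontr)
    assume "\<not> ?thesis"
    then have "card (parcs ?H `` {v}) = n - 4" if "v \<in> pverts ?H" for v
      using deg[of v] that VH by fastforce
    then have "even (card (pverts ?H))"
      using assms by (intro odd_regular_even_order[OF H, of "n - 4"]) auto
    then show False using VH V assms by auto
  qed
  then obtain v where "v \<in> pverts G" "n - 3 \<le> card (parcs ?H `` {v})" by blast
  then show thesis using that assms H VH V deg by (auto simp: dense_graph_def)
qed

section \<open>Circulant graphs\<close>

text \<open>For i, j < L this is the residue of j - i modulo L, split into cases to avoid truncated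
  subtraction.\<close>

definition circ_dist :: "nat \<Rightarrow> nat \<Rightarrow> nat \<Rightarrow> nat" where
  "circ_dist L i j = (if i \<le> j then j - i else j + L - i)"

text \<open>The connection set is that of the residues 1, ..., k and their negatives modulo L; for
  2k < L the two halves are disjoint and omit 0.\<close>

definition circulant :: "nat \<Rightarrow> nat \<Rightarrow> nat rel" where
  "circulant L k = {(i, j). i < L \<and> j < L \<and> circ_dist L i j \<in> {1..k} \<union> {L - k..<L}}"

lemma bij_betw_circ_dist: "i < L \<Longrightarrow> bij_betw (circ_dist L i) {..<L} {..<L}"
  by (rule bij_betw_byWitness[where f' = "\<lambda>s. if i + s < L then i + s else i + s - L"])
    (auto simp: circ_dist_def)

lemma card_circ_dist:
  assumes "i < L" "S \<subseteq> {..<L}"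
  shows "card {j. j < L \<and> circ_dist L i j \<in> S} = card S"
proof -
  let ?T = "{j. j < L \<and> circ_dist L i j \<in> S}"
  have bij: "inj_on (circ_dist L i) {..<L}" "circ_dist L i ` {..<L} = {..<L}"
    using bij_betw_circ_dist[OF assms(1)] by (auto simp: bij_betw_def)
  have "S \<subseteq> circ_dist L i ` ?T"
  proof
    fix s assume "s \<in> S"
    moreover from this obtain j where "j < L" "s = circ_dist L i j"
      using assms(2) bij(2) by blast
    ultimately show "s \<in> circ_dist L i ` ?T" by simp
  qed
  then have "circ_dist L i ` ?T = S" by auto
  moreover have "inj_on (circ_dist L i) ?T" by (rule inj_on_subset[OF bij(1)]) auto
  ultimately show ?thesis using card_image by metis
qed

lemma card_circulant:
  assumes "i < L" "2 * k < L"
  shows "card (circulant L k `` {i}) = 2 * k"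
proof -
  have "circulant L k `` {i} = {j. j < L \<and> circ_dist L i j \<in> {1..k} \<union> {L - k..<L}}"
    using assms by (auto simp: circulant_def)
  also have "card \<dots> = card ({1..k} \<union> {L - k..<L})"
    using assms by (intro card_circ_dist) auto
  also have "\<dots> = card {1..k} + card {L - k..<L}"
    using assms by (intro card_Un_disjoint) auto
  finally show ?thesis using assms by simp
qed

text \<open>Exchanging the endpoints turns a distance s into L - s, which swaps the two halves of
  the connection set.\<close>

lemma sym_circulant: "2 * k < L \<Longrightarrow> sym (circulant L k)"
  by (auto simp: sym_def circulant_def circ_dist_def split: if_splits)

lemma irrefl_circulant: "2 * k < L \<Longrightarrow> irrefl (circulant L k)"
  by (auto simp: irrefl_def circulant_def circ_dist_def)

section \<open>Lower bound: circulant hosts\<close>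

text \<open>The host is the circulant induced on its first \<open>M\<close> vertices. Restriction
  only lowers degrees, both in the graph and in its complement, so a single circulant refutes every
  M \<le> L at once.\<close>

lemma not_ramsey_property:
  assumes k: "2 * k < L" and "M \<le> L" "2 * k < d" "L - 1 - 2 * k < d'"
    and H: "pair_graph H" "{0} \<times> {1..d} \<subseteq> parcs H"
    and H': "pair_graph H'" "{0} \<times> {1..d'} \<subseteq> parcs H'"
  shows "\<not> ramsey_property H H' M"
proof
  assume ram: "ramsey_property H H' M"
  define G where "G = \<lparr> pverts = {..<M}, parcs = circulant L k \<inter> {..<M} \<times> {..<M} \<rparr>"
  have G: "pair_graph G"
    using sym_circulant[OF k] irrefl_circulant[OF k]
    by (intro pair_graphI) (auto simp: G_def sym_def irrefl_def)
  have fin: "finite (circulant L k `` {i})" for i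
    by (rule finite_subset[of _ "{..<L}"]) (auto simp: circulant_def)
  consider "contains_copy G H" | "contains_copy (complement_graph G) H'"
    using ram G unfolding ramsey_property_def by (fastforce simp: G_def)
  then show False
  proof cases
    case 1
    then obtain v where v: "v \<in> pverts G" "d \<le> card (parcs G `` {v})"
      using contains_copy_degree[OF G H(1) _ H(2)] assms by auto
    have "card (parcs G `` {v}) \<le> card (circulant L k `` {v})"
      using fin by (intro card_mono) (auto simp: G_def)
    then show False using v card_circulant[OF _ k, of v] assms by (auto simp: G_def)
  next
    case 2
    then obtain v where v: "v \<in> pverts (complement_graph G)"
        "d' \<le> card (parcs (complement_graph G) `` {v})"
      using contains_copy_degree[OF pair_graph_complement_graph[OF G] H'(1) _ H'(2)] assms by auto
    then have vM: "v < M" by (simp add: G_def complement_graph_def)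
    have sub: "circulant L k `` {v} \<subseteq> {..<L} - {v}"
      using irrefl_circulant[OF k] by (auto simp: circulant_def irrefl_def)
    have "card (parcs (complement_graph G) `` {v}) \<le> card (({..<L} - {v}) - circulant L k `` {v})"
      using \<open>M \<le> L\<close> by (intro card_mono) (auto simp: G_def complement_graph_def)
    also have "\<dots> = L - 1 - 2 * k"
      using sub fin vM \<open>M \<le> L\<close> card_circulant[OF _ k, of v] by (simp add: card_Diff_subset)
    finally show False using v assms by simp
  qed
qed

lemma ramsey_number_star_eq:
  assumes "7 \<le> m" "m + 2 \<le> n" "odd m"
    and H: "pair_graph H" "{0} \<times> {1..n - 3} \<subseteq> parcs H"
    and ram: "ramsey_property (star_graph (m - 1)) H (m + n - 5)"
  shows "ramsey_number (star_graph (m - 1)) H = m + n - 5"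
  unfolding ramsey_number_def
proof (rule Least_equality)
  obtain k where k: "m = 2 * k + 1" using \<open>odd m\<close> by (rule oddE)
  show "m + n - 5 \<le> M" if "0 < M \<and> ramsey_property (star_graph (m - 1)) H M" for M
  proof (rule ccontr)
    assume "\<not> m + n - 5 \<le> M"
    then have "\<not> ramsey_property (star_graph (m - 1)) H M"
      using k assms
      \<comment> \<open>The circulant has degree 2(k - 1) = m - 3, and its complement on m + n - 6
        vertices has degree n - 4, one less than the tree requires.\<close>
      by (intro not_ramsey_property[of "k - 1" "m + n - 6" M "m - 1" "n - 3"] pair_graph_star)
        (auto simp: star_graph_def mk_symmetric_with_proj)
    with that show False by simp
  qed
qed (use assms in simp)

theorem theorem4p3:
  fixes m n :: nat
  assumes "n > m" and "m \<ge> 6" and "\<not> 2 dvd m * n"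
  shows "ramsey_number (star_graph (m - 1)) (tree_T1 n) = m + n - 5
       \<and> ramsey_number (star_graph (m - 1)) (tree_T2 n) = m + n - 5"
proof -
  have odd: "odd m" "odd n" using assms by auto
  \<comment> \<open>Parity sharpens the bounds to those of \<open>dense_graph\<close>; the gap n - m
    \<ge> 2 is what the counting in \<open>W\<close> relies on.\<close>
  then have "m \<noteq> 6" "n \<noteq> m + 1" by auto
  then have mn: "7 \<le> m" "m + 2 \<le> n" using assms by auto
  have "ramsey_property (star_graph (m - 1)) (tree_T1 n) (m + n - 5)"
    using star_or_dense_complement[OF mn odd] dense_graph.contains_T1
    unfolding ramsey_property_def by metis
  moreover have "ramsey_property (star_graph (m - 1)) (tree_T2 n) (m + n - 5)"
    using star_or_dense_complement[OF mn odd] dense_graph.contains_T2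
    unfolding ramsey_property_def by metis
  moreover have "{0} \<times> {1..n - 3} \<subseteq> parcs (tree_T1 n)" "{0} \<times> {1..n - 3} \<subseteq> parcs (tree_T2 n)"
    by (auto simp: tree_T1_def tree_T2_def mk_symmetric_with_proj)
  ultimately show ?thesis
    using mn odd by (simp add: ramsey_number_star_eq pair_graph_tree_T1 pair_graph_tree_T2 del: One_nat_def)
qed

end
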